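(* The complex Lie algebra $\mathfrak{f}_{13}$ is strong characteristically nilpotent; that is, every ideal of $\mathfrak{f}_{13}$ of codimension 1 is characteristically nilpotent.
   Context: All Lie algebras are finite-dimensional over $\mathbb{C}$. A nilpotent Lie algebra is called characteristically nilpotent if it has no nonzero semisimple derivation (over $\mathbb{C}$ this is equivalent to every derivation being a nilpotent linear map). A nilpotent Lie algebra is called strong characteristically nilpotent if all its ideals of codimension 1 are characteristically nilpotent. $\mathfrak{f}_{13}$ is the 13-dimensional filiform complex Lie algebra with basis $e_0,e_1,\dots,e_{12}$ and the following brackets (extended by antisymmetry; all brackets $[e_i,e_j]$ with $i<j$ not listed are zero): $[e_0,e_i]=e_{i+1}$ for $1\le i\le 11$; $[e_1,e_2]=e_4$, $[e_1,e_3]=e_5$, $[e_1,e_4]=\frac{9}{10}e_6-e_8$, $[e_1,e_5]=\frac{4}{5}e_7-2e_9$, $[e_1,e_6]=\frac{5}{7}e_8-\frac{335}{126}e_{10}+\frac{22105}{15246}e_{12}$, $[e_1,e_7]=\frac{9}{14}e_9-\frac{125}{42}e_{11}$, $[e_1,e_8]=\frac{7}{12}e_{10}-\frac{4421}{1452}e_{12}$, $[e_1,e_9]=\frac{8}{15}e_{11}$, $[e_1,e_{10}]=\frac{27}{55}e_{12}$; $[e_2,e_3]=\frac{1}{10}e_6+e_8$, $[e_2,e_4]=\frac{1}{10}e_7+e_9$, $[e_2,e_5]=\frac{3}{35}e_8+\frac{83}{126}e_{10}-\frac{22105}{15246}e_{12}$, $[e_2,e_6]=\frac{1}{14}e_9+\frac{20}{63}e_{11}$,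 $[e_2,e_7]=\frac{5}{84}e_{10}+\frac{697}{10164}e_{12}$, $[e_2,e_8]=\frac{1}{20}e_{11}$, $[e_2,e_9]=\frac{7}{165}e_{12}$; $[e_3,e_4]=\frac{1}{70}e_8+\frac{43}{126}e_{10}+\frac{22105}{15246}e_{12}$, $[e_3,e_5]=\frac{1}{70}e_9+\frac{43}{126}e_{11}$, $[e_3,e_6]=\frac{1}{84}e_{10}+\frac{7589}{30492}e_{12}$, $[e_3,e_7]=\frac{1}{105}e_{11}$, $[e_3,e_8]=\frac{1}{132}e_{12}$; $[e_4,e_5]=\frac{1}{420}e_{10}+\frac{313}{3388}e_{12}$, $[e_4,e_6]=\frac{1}{420}e_{11}$, $[e_4,e_7]=\frac{3}{1540}e_{12}$; $[e_5,e_6]=\frac{1}{2310}e_{12}$. *)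

theory Defs
  imports "HOL-Analysis.Analysis"
begin

text \<open>
  A Lie algebra is given by a subspace \<open>L\<close> of an ambient complex vector space together with a
  bracket on the ambient type, of which only the values on \<open>L\<close> matter. In this way the ideals of a
  Lie algebra are Lie algebras for the same operations.
\<close>

locale lie_algebra = vector_space smul
  for smul :: "complex \<Rightarrow> 'a::ab_group_add \<Rightarrow> 'a" +
  fixes bracket :: "'a \<Rightarrow> 'a \<Rightarrow> 'a"
    and L :: "'a set"
  assumes subspace_L: "subspace L"
    and finite_dim: "\<exists>B. finite B \<and> span B = L"
    and bracket_closed: "\<lbrakk>x \<in> L; y \<in> L\<rbrakk> \<Longrightarrow> bracket x y \<in> L"
    and bracket_add_left:
      "\<lbrakk>x \<in> L; y \<in> L; z \<in> L\<rbrakk> \<Longrightarrow> bracket (x + y) z = bracket x z + bracket y z"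
    and bracket_add_right:
      "\<lbrakk>x \<in> L; y \<in> L; z \<in> L\<rbrakk> \<Longrightarrow> bracket x (y + z) = bracket x y + bracket x z"
    and bracket_scale_left:
      "\<lbrakk>x \<in> L; y \<in> L\<rbrakk> \<Longrightarrow> bracket (smul c x) y = smul c (bracket x y)"
    and bracket_scale_right:
      "\<lbrakk>x \<in> L; y \<in> L\<rbrakk> \<Longrightarrow> bracket x (smul c y) = smul c (bracket x y)"
    and bracket_self: "x \<in> L \<Longrightarrow> bracket x x = 0"
    and jacobi: "\<lbrakk>x \<in> L; y \<in> L; z \<in> L\<rbrakk> \<Longrightarrow>
      bracket x (bracket y z) + bracket y (bracket z x) + bracket z (bracket x y) = 0"

definition lie_ideal ::
  "(complex \<Rightarrow> 'a::ab_group_add \<Rightarrow> 'a) \<Rightarrow> ('a \<Rightarrow> 'a \<Rightarrow> 'a) \<Rightarrow> 'a set \<Rightarrow> 'a set \<Rightarrow> bool" where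
  "lie_ideal smul bracket L I \<longleftrightarrow>
     module.subspace smul I \<and> I \<subseteq> L \<and> (\<forall>x\<in>L. \<forall>y\<in>I. bracket x y \<in> I)"

primrec lower_central_series ::
  "(complex \<Rightarrow> 'a::ab_group_add \<Rightarrow> 'a) \<Rightarrow> ('a \<Rightarrow> 'a \<Rightarrow> 'a) \<Rightarrow> 'a set \<Rightarrow> nat \<Rightarrow> 'a set" where
  "lower_central_series smul bracket L 0 = L"
| "lower_central_series smul bracket L (Suc k) =
     module.span smul {bracket x y | x y. x \<in> L \<and> y \<in> lower_central_series smul bracket L k}"

definition nilpotent_lie_algebra ::
  "(complex \<Rightarrow> 'a::ab_group_add \<Rightarrow> 'a) \<Rightarrow> ('a \<Rightarrow> 'a \<Rightarrow> 'a) \<Rightarrow> 'a set \<Rightarrow> bool" where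
  "nilpotent_lie_algebra smul bracket L \<longleftrightarrow>
     lie_algebra smul bracket L \<and> (\<exists>k. lower_central_series smul bracket L k = {0})"

text \<open>
  Linear endomorphisms of \<open>L\<close> are represented by functions on the ambient type whose values
  outside \<open>L\<close> are irrelevant.
\<close>

definition endomorphism_on ::
  "(complex \<Rightarrow> 'a::ab_group_add \<Rightarrow> 'a) \<Rightarrow> 'a set \<Rightarrow> ('a \<Rightarrow> 'a) \<Rightarrow> bool" where
  "endomorphism_on smul L D \<longleftrightarrow>
     D ` L \<subseteq> L \<and>
     (\<forall>x\<in>L. \<forall>y\<in>L. D (x + y) = D x + D y) \<and>
     (\<forall>c. \<forall>x\<in>L. D (smul c x) = smul c (D x))"

definition derivation_on ::
  "(complex \<Rightarrow> 'a::ab_group_add \<Rightarrow> 'a) \<Rightarrow> ('a \<Rightarrow> 'a \<Rightarrow> 'a) \<Rightarrow> 'a set \<Rightarrow> ('a \<Rightarrow> 'a) \<Rightarrow> bool" where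
  "derivation_on smul bracket L D \<longleftrightarrow>
     endomorphism_on smul L D \<and>
     (\<forall>x\<in>L. \<forall>y\<in>L. D (bracket x y) = bracket (D x) y + bracket x (D y))"

text \<open>
  An endomorphism is semisimple if every invariant subspace has an invariant complement; over the
  complex numbers and in finite dimension this is the same as being diagonalizable.
\<close>

definition semisimple_on ::
  "(complex \<Rightarrow> 'a::ab_group_add \<Rightarrow> 'a) \<Rightarrow> 'a set \<Rightarrow> ('a \<Rightarrow> 'a) \<Rightarrow> bool" where
  "semisimple_on smul L D \<longleftrightarrow>
     (\<forall>U. module.subspace smul U \<and> U \<subseteq> L \<and> D ` U \<subseteq> U \<longrightarrow>
       (\<exists>W. module.subspace smul W \<and> W \<subseteq> L \<and> D ` W \<subseteq> W \<and>
            U \<inter> W = {0} \<and> {u + w | u w. u \<in> U \<and> w \<in> W} = L))"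

definition characteristically_nilpotent ::
  "(complex \<Rightarrow> 'a::ab_group_add \<Rightarrow> 'a) \<Rightarrow> ('a \<Rightarrow> 'a \<Rightarrow> 'a) \<Rightarrow> 'a set \<Rightarrow> bool" where
  "characteristically_nilpotent smul bracket L \<longleftrightarrow>
     nilpotent_lie_algebra smul bracket L \<and>
     \<not> (\<exists>D. derivation_on smul bracket L D \<and> semisimple_on smul L D \<and> (\<exists>x\<in>L. D x \<noteq> 0))"

definition strong_characteristically_nilpotent ::
  "(complex \<Rightarrow> 'a::ab_group_add \<Rightarrow> 'a) \<Rightarrow> ('a \<Rightarrow> 'a \<Rightarrow> 'a) \<Rightarrow> 'a set \<Rightarrow> bool" where
  "strong_characteristically_nilpotent smul bracket L \<longleftrightarrow>
     nilpotent_lie_algebra smul bracket L \<and>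
     (\<forall>I. lie_ideal smul bracket L I \<and>
          vector_space.dim smul L = vector_space.dim smul I + 1 \<longrightarrow>
          characteristically_nilpotent smul bracket I)"

text \<open>
  The underlying space of the filiform algebra is \<open>complex ^ 13\<close>. The index type \<open>13\<close> consists of
  the residues modulo 13, and the basis vector \<open>f13_e i\<close> is used for \<open>i < 13\<close> only.
\<close>

definition f13_e :: "nat \<Rightarrow> (complex ^ 13)" where
  "f13_e i = axis (of_nat i) 1"

definition f13_brackets :: "((nat \<times> nat) \<times> (complex ^ 13)) list" where
  "f13_brackets =
    [((0,1), f13_e 2), ((0,2), f13_e 3), ((0,3), f13_e 4), ((0,4), f13_e 5),
     ((0,5), f13_e 6), ((0,6), f13_e 7), ((0,7), f13_e 8), ((0,8), f13_e 9),
     ((0,9), f13_e 10), ((0,10), f13_e 11), ((0,11), f13_e 12),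
     ((1,2), f13_e 4),
     ((1,3), f13_e 5),
     ((1,4), (9/10) *s f13_e 6 - f13_e 8),
     ((1,5), (4/5) *s f13_e 7 - 2 *s f13_e 9),
     ((1,6), (5/7) *s f13_e 8 - (335/126) *s f13_e 10 + (22105/15246) *s f13_e 12),
     ((1,7), (9/14) *s f13_e 9 - (125/42) *s f13_e 11),
     ((1,8), (7/12) *s f13_e 10 - (4421/1452) *s f13_e 12),
     ((1,9), (8/15) *s f13_e 11),
     ((1,10), (27/55) *s f13_e 12),
     ((2,3), (1/10) *s f13_e 6 + f13_e 8),
     ((2,4), (1/10) *s f13_e 7 + f13_e 9),
     ((2,5), (3/35) *s f13_e 8 + (83/126) *s f13_e 10 - (22105/15246) *s f13_e 12),
     ((2,6), (1/14) *s f13_e 9 + (20/63) *s f13_e 11),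
     ((2,7), (5/84) *s f13_e 10 + (697/10164) *s f13_e 12),
     ((2,8), (1/20) *s f13_e 11),
     ((2,9), (7/165) *s f13_e 12),
     ((3,4), (1/70) *s f13_e 8 + (43/126) *s f13_e 10 + (22105/15246) *s f13_e 12),
     ((3,5), (1/70) *s f13_e 9 + (43/126) *s f13_e 11),
     ((3,6), (1/84) *s f13_e 10 + (7589/30492) *s f13_e 12),
     ((3,7), (1/105) *s f13_e 11),
     ((3,8), (1/132) *s f13_e 12),
     ((4,5), (1/420) *s f13_e 10 + (313/3388) *s f13_e 12),
     ((4,6), (1/420) *s f13_e 11),
     ((4,7), (3/1540) *s f13_e 12),
     ((5,6), (1/2310) *s f13_e 12)]"

text \<open>\<open>f13_table i j\<close> is the bracket of the \<open>i\<close>-th and \<open>j\<close>-th basis vectors for \<open>i < j\<close>.\<close>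

definition f13_table :: "nat \<Rightarrow> nat \<Rightarrow> (complex ^ 13)" where
  "f13_table i j = (case map_of f13_brackets (i, j) of Some v \<Rightarrow> v | None \<Rightarrow> 0)"

text \<open>The alternating bilinear extension of the table.\<close>

definition f13_bracket :: "(complex ^ 13) \<Rightarrow> (complex ^ 13) \<Rightarrow> (complex ^ 13)" where
  "f13_bracket x y =
     (\<Sum>j<13. \<Sum>i<j. (x $ of_nat i * y $ of_nat j - x $ of_nat j * y $ of_nat i) *s f13_table i j)"

lemma of_nat_13_eq_iff:
  assumes "i < 13" "j < 13"
  shows "(of_nat i :: 13) = of_nat j \<longleftrightarrow> i = j"
proof -
  have *: "m = n" if "m \<le> n" "n < 13" "(of_nat m :: 13) = of_nat n" for m n :: nat
  proof -
    have "(of_nat (n - m) :: 13) = 0"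
      using that by (simp add: of_nat_diff)
    then have "13 dvd n - m"
      by (simp add: of_nat_eq_0_iff_char_dvd)
    with that show ?thesis
      by (auto dest: dvd_imp_le)
  qed
  show ?thesis
    using *[of i j] *[of j i] assms by (metis nle_le)
qed

lemma f13_bracket_basis:
  assumes "i < j" "j < 13"
  shows "f13_bracket (f13_e i) (f13_e j) = f13_table i j"
proof -
  have *: "f13_e k $ of_nat l = (if k = l then 1 else 0)" if "k < 13" "l < 13" for k l
    using that of_nat_13_eq_iff[of k l] by (auto simp: f13_e_def axis_def)
  have "f13_bracket (f13_e i) (f13_e j) =
      (\<Sum>l<13. \<Sum>k<l. if k = i then (if l = j then f13_table i j else 0) else 0)"
    unfolding f13_bracket_def using assms
    by (intro sum.cong refl) (auto simp: *)
  also have "\<dots> = (\<Sum>l<13. if l = j then f13_table i j else 0)"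
    using assms by (intro sum.cong refl) auto
  also have "\<dots> = f13_table i j"
    using assms by simp
  finally show ?thesis .
qed

end

theory Submission
  imports Defs
begin

text \<open>
Give \<open>e\<^sub>0\<close> degree \<open>1\<close> and \<open>e\<^sub>i\<close> degree \<open>i + 1\<close> for \<open>i \<ge> 1\<close>. The bracket of \<open>f\<^sub>1\<^sub>3\<close> is the sum of a
homogeneous part and of parts that raise the degree by 2 and by 4. In particular it respects the
filtration \<open>F\<^sub>k = \<langle>e\<^sub>k, \<dots>, e\<^sub>1\<^sub>2\<rangle>\<close>, in the form \<open>[F\<^sub>m, F\<^sub>n] \<subseteq> F\<^sub>m\<^sub>+\<^sub>n\<^sub>+\<^sub>1\<close>
(\<open>f13_bracket_filtration\<close>), and the algebra is nilpotent.

An ideal \<open>I\<close> of codimension 1 contains every bracket, hence contains \<open>F\<^sub>2\<close>. So \<open>I\<close> is spanned by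
\<open>F\<^sub>2\<close> and one more vector, which can be taken to be \<open>v = e\<^sub>0 + t e\<^sub>1\<close> or \<open>e\<^sub>1\<close>
(\<open>f13_codim_1_ideal_cases\<close>). In both cases the claim is that a derivation \<open>D\<close> of \<open>I\<close> is
nilpotent, more precisely that \<open>D\<close> moves \<open>I\<close> into \<open>F\<^sub>2\<close> and each \<open>F\<^sub>k\<close> with \<open>k \<ge> 2\<close> into
\<open>F\<^sub>k\<^sub>+\<^sub>1\<close>. This is enough, because a semisimple endomorphism that is nilpotent vanishes
(\<open>semisimple_nilpotent_eq_zero\<close>).

To see the claim, one shows first that \<open>D\<close> preserves the filtration, that is, does not lower
degrees. Its part of degree 0 is then diagonal, and the homogeneous part of the bracket forces its
eigenvalues to be proportional to the degrees, with a common factor that must be shown to vanish.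
A multiple of the degree operator extends to a derivation of \<open>I\<close> only if the parts of the bracket
that raise the degree can be compensated by the parts of \<open>D\<close> that raise it, and the structure
constants make this impossible at the first occasion. When \<open>v = e\<^sub>0 + t e\<^sub>1\<close> with \<open>t \<noteq> 0\<close>, the summand
\<open>t e\<^sub>1\<close> disturbs the grading of \<open>I\<close> in degree 1, and the part of \<open>D\<close> of degree 1 cannot make up for
it. When \<open>v = e\<^sub>0\<close>, and when \<open>v\<close> is replaced by \<open>e\<^sub>1\<close>, the obstruction sits in degree 2. These are
the two lemmas \<open>derivation_nilpotent_with_e0\<close> and \<open>derivation_nilpotent_without_e0\<close>.
\<close>

section \<open>Semisimple endomorphisms and ideals\<close>

text \<open>
The kernel of \<open>D\<close> has an invariant complement. On it \<open>D\<close> is both injective and nilpotent, so the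
complement is zero.
\<close>

lemma semisimple_nilpotent_eq_zero:
  fixes smul :: "complex \<Rightarrow> 'a::ab_group_add \<Rightarrow> 'a"
  assumes "vector_space smul" "module.subspace smul L" "endomorphism_on smul L D"
    "semisimple_on smul L D" "\<And>x. x \<in> L \<Longrightarrow> (D ^^ n) x = 0" "x \<in> L"
  shows "D x = 0"
proof -
  interpret vector_space smul by fact
  let ?K = "{y \<in> L. D y = 0}"
  have L: "0 \<in> L" "\<And>x y. x \<in> L \<Longrightarrow> y \<in> L \<Longrightarrow> x + y \<in> L" "\<And>c x. x \<in> L \<Longrightarrow> smul c x \<in> L"
    using assms(2) by (auto simp: subspace_def)
  have D: "\<And>x. x \<in> L \<Longrightarrow> D x \<in> L" "\<And>x y. x \<in> L \<Longrightarrow> y \<in> L \<Longrightarrow> D (x + y) = D x + D y"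
    "\<And>c x. x \<in> L \<Longrightarrow> D (smul c x) = smul c (D x)"
    using assms(3) by (auto simp: endomorphism_on_def)
  have D0: "D 0 = 0"
    using D(2)[of 0 0] L(1) by simp
  have "subspace ?K"
    by (rule subspaceI) (auto simp: L D D0)
  moreover have "D ` ?K \<subseteq> ?K"
    using L(1) D0 by auto
  ultimately obtain W where W: "subspace W" "W \<subseteq> L" "D ` W \<subseteq> W" "?K \<inter> W = {0}"
    "{u + w | u w. u \<in> ?K \<and> w \<in> W} = L"
    using assms(4) unfolding semisimple_on_def by (elim allE[of _ ?K]) auto
  have "w = 0" if "(D ^^ k) w = 0" "w \<in> W" for k w
    using that
  proof (induction k arbitrary: w)
    case (Suc k)
    have "D w = 0"
      using Suc W(3) by (auto simp: funpow_swap1)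
    then show ?case
      using Suc.prems(2) W(2,4) by blast
  qed simp
  then have W0: "W \<subseteq> {0}"
    using W(2) assms(5) by blast
  from W(5) assms(6) obtain u w where "u \<in> ?K" "w \<in> W" "x = u + w"
    by blast
  with W0 show ?thesis
    by auto
qed

lemma lie_algebra_ideal:
  assumes "lie_algebra smul bracket L" "lie_ideal smul bracket L I"
  shows "lie_algebra smul bracket I"
proof -
  interpret lie_algebra smul bracket L by fact
  have I: "subspace I" "I \<subseteq> L" "\<And>x y. x \<in> L \<Longrightarrow> y \<in> I \<Longrightarrow> bracket x y \<in> I"
    using assms(2) by (auto simp: lie_ideal_def)
  obtain B where B: "finite B" "span B = L"
    using finite_dim by blast
  obtain C where C: "C \<subseteq> I" "independent C" "I \<subseteq> span C"
    using basis_exists by metis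
  have "finite C"
    using independent_span_bound[OF B(1) C(2)] C(1) I(2) B(2) by blast
  moreover have "span C = I"
    using C I(1) by (simp add: span_subspace)
  ultimately have fin: "\<exists>B. finite B \<and> span B = I"
    by blast
  have IL: "x \<in> L" if "x \<in> I" for x
    using that I(2) by blast
  show ?thesis
    by unfold_locales
      (simp_all add: fin I IL bracket_add_left bracket_add_right bracket_scale_left
        bracket_scale_right bracket_self jacobi)
qed

lemma lower_central_series_mono:
  assumes "vector_space smul" "I \<subseteq> L"
  shows "lower_central_series smul bracket I k \<subseteq> lower_central_series smul bracket L k"
proof -
  interpret vector_space smul by fact
  show ?thesis
  proof (induction k)
    case (Suc k)
    then show ?case
      using assms(2) by simp (rule span_mono, blast)
  qed (use assms in simp)
qed

lemma nilpotent_lie_algebra_ideal: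
  assumes "nilpotent_lie_algebra smul bracket L" "lie_ideal smul bracket L I"
  shows "nilpotent_lie_algebra smul bracket I"
proof -
  from assms(1) obtain k where k: "lie_algebra smul bracket L" "lower_central_series smul bracket L k = {0}"
    by (auto simp: nilpotent_lie_algebra_def)
  interpret I: lie_algebra smul bracket I
    using lie_algebra_ideal[OF k(1) assms(2)] .
  have "I.subspace (lower_central_series smul bracket I j)" for j
    by (cases j) (auto simp: I.subspace_L)
  then have "0 \<in> lower_central_series smul bracket I k"
    using I.subspace_0 by blast
  moreover have "lower_central_series smul bracket I k \<subseteq> {0}"
    using lower_central_series_mono[OF I.vector_space_axioms, of I L] k(2) assms(2)
    by (auto simp: lie_ideal_def)
  ultimately show ?thesis
    using I.lie_algebra_axioms unfolding nilpotent_lie_algebra_def by blast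
qed

text \<open>
Modulo \<open>I\<close> every element is a multiple of the single vector \<open>u\<close>, and \<open>[u, u] = 0\<close>.
\<close>

lemma bracket_in_codim_1_ideal:
  assumes "lie_algebra smul bracket L" "lie_ideal smul bracket L I"
    and span: "\<And>x. x \<in> L \<Longrightarrow> \<exists>y\<in>I. \<exists>c. x = y + smul c u"
    and "u \<in> L" "x \<in> L" "y \<in> L"
  shows "bracket x y \<in> I"
proof -
  interpret lie_algebra smul bracket L by fact
  have I: "subspace I" "I \<subseteq> L" "\<And>x y. x \<in> L \<Longrightarrow> y \<in> I \<Longrightarrow> bracket x y \<in> I"
    using assms(2) by (auto simp: lie_ideal_def)
  obtain a c where a: "a \<in> I" "x = a + smul c u" using assms by blast
  obtain b d where b: "b \<in> I" "y = b + smul d u" using assms by blast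
  have mem: "a \<in> L" "b \<in> L" "u \<in> L" "smul c u \<in> L" "smul d u \<in> L" "a + smul c u \<in> L"
    using a b I subspace_L assms by (auto simp: subspace_def)
  have "bracket a u = - bracket u a"
    using bracket_self[of "a + u"] bracket_self[of a] bracket_self[of u] mem subspace_L
    by (simp add: bracket_add_left bracket_add_right subspace_def eq_neg_iff_add_eq_0 add.commute)
  then have "bracket x y = bracket x b - smul d (bracket u a)"
    using mem by (simp add: a b bracket_add_right bracket_add_left bracket_scale_left
        bracket_scale_right bracket_self)
  then show ?thesis
    using I mem a b by (metis subspace_diff subspace_scale)
qed

section \<open>Coordinates of the bracket\<close>

text \<open>
Indexing coordinates by natural numbers makes comparisons such as \<open>i < k\<close> meaningful, which they are
not for residues. The index is taken modulo 13, so only \<open>i < 13\<close> carries information.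
\<close>

definition coord :: "complex ^ 13 \<Rightarrow> nat \<Rightarrow> complex" where
  "coord x i = x $ of_nat i"

lemma coord_add [simp]: "coord (x + y) i = coord x i + coord y i"
  and coord_diff [simp]: "coord (x - y) i = coord x i - coord y i"
  and coord_scale [simp]: "coord (c *s x) i = c * coord x i"
  and coord_zero [simp]: "coord 0 i = 0"
  by (simp_all add: coord_def)

lemma coord_basis:
  "i < 13 \<Longrightarrow> k < 13 \<Longrightarrow> coord (f13_e i) k = (if k = i then 1 else 0)"
  using of_nat_13_eq_iff[of k i] by (auto simp: coord_def f13_e_def axis_def)

lemma of_nat_13_surj: "\<exists>k<13. (i :: 13) = of_nat k"
proof -
  have "card ((of_nat :: nat \<Rightarrow> 13) ` {..<13}) = card {..<13::nat}"
    by (rule card_image) (auto simp: inj_on_def of_nat_13_eq_iff)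
  then have "card ((of_nat :: nat \<Rightarrow> 13) ` {..<13}) = card (UNIV :: 13 set)"
    by simp
  then have "(of_nat :: nat \<Rightarrow> 13) ` {..<13} = UNIV"
    by (intro card_subset_eq) auto
  then show ?thesis by (metis UNIV_I image_iff lessThan_iff)
qed

lemma coord_ext: "(\<And>k. k < 13 \<Longrightarrow> coord x k = coord y k) \<Longrightarrow> x = y"
  unfolding coord_def vec_eq_iff by (metis of_nat_13_surj)

text \<open>
The sum over all index pairs collapses to the listed ones. This is what makes the coordinates of the
bracket computable in one rewriting pass over the 36 table entries.
\<close>

lemma sum_list_map_of:
  fixes g :: "nat \<Rightarrow> nat \<Rightarrow> complex" and ps :: "((nat \<times> nat) \<times> (complex ^ 'n)) list"
  assumes "distinct (map fst ps)" "\<forall>(p, w)\<in>set ps. fst p < snd p \<and> snd p < n"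
  shows "(\<Sum>j<n. \<Sum>i<j. g i j *s (case map_of ps (i, j) of Some v \<Rightarrow> v | None \<Rightarrow> 0)) =
    (\<Sum>(p, w)\<leftarrow>ps. g (fst p) (snd p) *s w)"
  using assms
proof (induction ps)
  case Nil
  then show ?case by simp
next
  case (Cons q ps)
  obtain a b w where q: "q = ((a, b), w)" by (metis prod.exhaust)
  have ab: "a < b" "b < n" "map_of ps (a, b) = None"
    using Cons.prems by (auto simp: q map_of_eq_None_iff)
  let ?c = "\<lambda>ps i j. case map_of ps (i, j) of Some v \<Rightarrow> v | None \<Rightarrow> 0"
  have "(\<Sum>j<n. \<Sum>i<j. g i j *s ?c (q # ps) i j) =
    (\<Sum>j<n. \<Sum>i<j. (if i = a then if j = b then g a b *s w else 0 else 0) + g i j *s ?c ps i j)"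
    using ab by (intro sum.cong refl) (auto simp: q)
  also have "\<dots> = (\<Sum>j<n. \<Sum>i<j. if i = a then if j = b then g a b *s w else 0 else 0) +
      (\<Sum>j<n. \<Sum>i<j. g i j *s ?c ps i j)"
    by (simp only: sum.distrib)
  also have "(\<Sum>j<n. \<Sum>i<j. if i = a then if j = b then g a b *s w else 0 else 0) =
      (\<Sum>j<n. if j = b then g a b *s w else 0)"
    using ab by (intro sum.cong refl) auto
  also have "\<dots> = g a b *s w" using ab by simp
  finally show ?case using Cons by (simp add: q)
qed

lemma f13_bracket_eq_sum_list:
  "f13_bracket x y =
    (\<Sum>(p, w)\<leftarrow>f13_brackets.
      (coord x (fst p) * coord y (snd p) - coord x (snd p) * coord y (fst p)) *s w)"
  unfolding f13_bracket_def f13_table_def coord_def[symmetric]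
  by (rule sum_list_map_of) (simp_all add: f13_brackets_def)

lemma coord_sum_list: "coord (sum_list vs) k = (\<Sum>v\<leftarrow>vs. coord v k)"
  by (induction vs) auto

lemma coord_f13_bracket:
  "coord (f13_bracket x y) 0 = 0"
  "coord (f13_bracket x y) 1 = 0"
  "coord (f13_bracket x y) 2 = coord x 0 * coord y 1 - coord x 1 * coord y 0"
  "coord (f13_bracket x y) 3 = coord x 0 * coord y 2 - coord x 2 * coord y 0"
  "coord (f13_bracket x y) 4 = (coord x 0 * coord y 3 - coord x 3 * coord y 0)
      + (coord x 1 * coord y 2 - coord x 2 * coord y 1)"
  "coord (f13_bracket x y) 5 = (coord x 0 * coord y 4 - coord x 4 * coord y 0)
      + (coord x 1 * coord y 3 - coord x 3 * coord y 1)"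
  "coord (f13_bracket x y) 6 = (coord x 0 * coord y 5 - coord x 5 * coord y 0)
      + (9/10) * (coord x 1 * coord y 4 - coord x 4 * coord y 1)
      + (1/10) * (coord x 2 * coord y 3 - coord x 3 * coord y 2)"
  "coord (f13_bracket x y) 7 = (coord x 0 * coord y 6 - coord x 6 * coord y 0)
      + (4/5) * (coord x 1 * coord y 5 - coord x 5 * coord y 1)
      + (1/10) * (coord x 2 * coord y 4 - coord x 4 * coord y 2)"
  "coord (f13_bracket x y) 8 = (coord x 0 * coord y 7 - coord x 7 * coord y 0)
      - (coord x 1 * coord y 4 - coord x 4 * coord y 1)
      + (5/7) * (coord x 1 * coord y 6 - coord x 6 * coord y 1)
      + (coord x 2 * coord y 3 - coord x 3 * coord y 2)
      + (3/35) * (coord x 2 * coord y 5 - coord x 5 * coord y 2)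
      + (1/70) * (coord x 3 * coord y 4 - coord x 4 * coord y 3)"
  "coord (f13_bracket x y) 9 = (coord x 0 * coord y 8 - coord x 8 * coord y 0)
      - 2 * (coord x 1 * coord y 5 - coord x 5 * coord y 1)
      + (9/14) * (coord x 1 * coord y 7 - coord x 7 * coord y 1)
      + (coord x 2 * coord y 4 - coord x 4 * coord y 2)
      + (1/14) * (coord x 2 * coord y 6 - coord x 6 * coord y 2)
      + (1/70) * (coord x 3 * coord y 5 - coord x 5 * coord y 3)"
  "coord (f13_bracket x y) 10 = (coord x 0 * coord y 9 - coord x 9 * coord y 0)
      - (335/126) * (coord x 1 * coord y 6 - coord x 6 * coord y 1)
      + (7/12) * (coord x 1 * coord y 8 - coord x 8 * coord y 1)
      + (83/126) * (coord x 2 * coord y 5 - coord x 5 * coord y 2)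
      + (5/84) * (coord x 2 * coord y 7 - coord x 7 * coord y 2)
      + (43/126) * (coord x 3 * coord y 4 - coord x 4 * coord y 3)
      + (1/84) * (coord x 3 * coord y 6 - coord x 6 * coord y 3)
      + (1/420) * (coord x 4 * coord y 5 - coord x 5 * coord y 4)"
  "coord (f13_bracket x y) 11 = (coord x 0 * coord y 10 - coord x 10 * coord y 0)
      - (125/42) * (coord x 1 * coord y 7 - coord x 7 * coord y 1)
      + (8/15) * (coord x 1 * coord y 9 - coord x 9 * coord y 1)
      + (20/63) * (coord x 2 * coord y 6 - coord x 6 * coord y 2)
      + (1/20) * (coord x 2 * coord y 8 - coord x 8 * coord y 2)
      + (43/126) * (coord x 3 * coord y 5 - coord x 5 * coord y 3)
      + (1/105) * (coord x 3 * coord y 7 - coord x 7 * coord y 3)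
      + (1/420) * (coord x 4 * coord y 6 - coord x 6 * coord y 4)"
  "coord (f13_bracket x y) 12 = (coord x 0 * coord y 11 - coord x 11 * coord y 0)
      + (22105/15246) * (coord x 1 * coord y 6 - coord x 6 * coord y 1)
      - (4421/1452) * (coord x 1 * coord y 8 - coord x 8 * coord y 1)
      + (27/55) * (coord x 1 * coord y 10 - coord x 10 * coord y 1)
      - (22105/15246) * (coord x 2 * coord y 5 - coord x 5 * coord y 2)
      + (697/10164) * (coord x 2 * coord y 7 - coord x 7 * coord y 2)
      + (7/165) * (coord x 2 * coord y 9 - coord x 9 * coord y 2)
      + (22105/15246) * (coord x 3 * coord y 4 - coord x 4 * coord y 3)
      + (7589/30492) * (coord x 3 * coord y 6 - coord x 6 * coord y 3)
      + (1/132) * (coord x 3 * coord y 8 - coord x 8 * coord y 3)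
      + (313/3388) * (coord x 4 * coord y 5 - coord x 5 * coord y 4)
      + (3/1540) * (coord x 4 * coord y 7 - coord x 7 * coord y 4)
      + (1/2310) * (coord x 5 * coord y 6 - coord x 6 * coord y 5)"
  by (simp_all add: f13_bracket_eq_sum_list f13_brackets_def coord_basis
      del: left_diff_distrib_numeral right_diff_distrib_numeral)
    algebra+

lemma f13_jacobi:
  "f13_bracket x (f13_bracket y z) + f13_bracket y (f13_bracket z x)
    + f13_bracket z (f13_bracket x y) = 0" (is "?J = 0")
proof (rule coord_ext)
  have "coord ?J 0 = 0" "coord ?J 1 = 0"
    by (simp_all only: coord_f13_bracket coord_add add_0)
  moreover have "coord ?J 2 = 0"
    unfolding coord_add coord_f13_bracket by algebra
  moreover have "coord ?J 3 = 0"
    unfolding coord_add coord_f13_bracket by algebra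
  moreover have "coord ?J 4 = 0"
    unfolding coord_add coord_f13_bracket by algebra
  moreover have "coord ?J 5 = 0"
    unfolding coord_add coord_f13_bracket by algebra
  moreover have "coord ?J 6 = 0"
    unfolding coord_add coord_f13_bracket by algebra
  moreover have "coord ?J 7 = 0"
    unfolding coord_add coord_f13_bracket by algebra
  moreover have "coord ?J 8 = 0"
    unfolding coord_add coord_f13_bracket by algebra
  moreover have "coord ?J 9 = 0"
    unfolding coord_add coord_f13_bracket by algebra
  moreover have "coord ?J 10 = 0"
    unfolding coord_add coord_f13_bracket by algebra
  moreover have "coord ?J 11 = 0"
    unfolding coord_add coord_f13_bracket by algebra
  moreover have "coord ?J 12 = 0"
    unfolding coord_add coord_f13_bracket by algebra
  ultimately show "coord ?J k = coord 0 k" if "k < 13" for k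
    using that by (auto simp: less_Suc_eq eval_nat_numeral)
qed

lemma f13_bracket_add_left: "f13_bracket (x + y) z = f13_bracket x z + f13_bracket y z"
  and f13_bracket_add_right: "f13_bracket x (y + z) = f13_bracket x y + f13_bracket x z"
  by (simp_all add: f13_bracket_def flip: sum.distrib vec.scale_left_distrib)
    (simp_all add: algebra_simps)

lemma f13_bracket_scale_left: "f13_bracket (c *s x) y = c *s f13_bracket x y"
  and f13_bracket_scale_right: "f13_bracket x (c *s y) = c *s f13_bracket x y"
  by (simp_all add: f13_bracket_def vec.scale_sum_right right_diff_distrib mult.assoc mult.left_commute)

lemma lie_algebra_f13: "lie_algebra (*s) f13_bracket UNIV"
proof unfold_locales
  show "\<exists>B. finite B \<and> vec.span B = (UNIV :: (complex ^ 13) set)"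
    using finite_cart_basis span_cart_basis by blast
  show "f13_bracket x x = 0" for x
    by (simp add: f13_bracket_def)
qed (simp_all add: f13_jacobi f13_bracket_add_left f13_bracket_add_right
  f13_bracket_scale_left f13_bracket_scale_right)

section \<open>The filtration\<close>

text \<open>
This is the span of \<open>e\<^sub>k, \<dots>, e\<^sub>1\<^sub>2\<close>, and zero for \<open>k \<ge> 13\<close>. Only the indices below 13 are mentioned
because all others repeat them.
\<close>

definition f13_filtration :: "nat \<Rightarrow> (complex ^ 13) set" where
  "f13_filtration k = {x. \<forall>i<13. i < k \<longrightarrow> coord x i = 0}"

lemma f13_filtrationD: "x \<in> f13_filtration k \<Longrightarrow> i < k \<Longrightarrow> i < 13 \<Longrightarrow> coord x i = 0"
  by (simp add: f13_filtration_def)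

lemma subspace_f13_filtration: "vec.subspace (f13_filtration k)"
  by (rule vec.subspaceI) (simp_all add: f13_filtration_def)

lemma f13_filtration_antimono: "k \<le> l \<Longrightarrow> f13_filtration l \<subseteq> f13_filtration k"
  by (auto simp: f13_filtration_def)

lemma f13_filtration_0: "f13_filtration 0 = UNIV"
  by (simp add: f13_filtration_def)

lemma f13_filtration_eq_0: "13 \<le> k \<Longrightarrow> f13_filtration k = {0}"
  by (auto simp: f13_filtration_def intro!: coord_ext)

lemma basis_in_filtration: "i < 13 \<Longrightarrow> k \<le> i \<Longrightarrow> f13_e i \<in> f13_filtration k"
  by (auto simp: f13_filtration_def coord_basis)

lemma filtration_minus_leading:
  "x \<in> f13_filtration k \<Longrightarrow> k < 13 \<Longrightarrow> x - coord x k *s f13_e k \<in> f13_filtration (Suc k)"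
  by (auto simp: f13_filtration_def coord_basis less_Suc_eq)

text \<open>
The bracket does not lower degrees: \<open>[e\<^sub>i, e\<^sub>j]\<close> starts at \<open>e\<^sub>i\<^sub>+\<^sub>j\<^sub>+\<^sub>1\<close>, also when \<open>i = 0\<close>.
\<close>

lemma f13_brackets_degree:
  assumes "q \<in> set f13_brackets"
  shows "fst (fst q) < snd (fst q)" "snd (fst q) < 13"
    "k \<le> fst (fst q) + snd (fst q) \<Longrightarrow> k < 13 \<Longrightarrow> coord (snd q) k = 0"
  using assms by (auto simp: f13_brackets_def coord_basis)

lemma sum_list_eq_zero:
  "(\<And>q. q \<in> set qs \<Longrightarrow> f q = 0) \<Longrightarrow> (\<Sum>q\<leftarrow>qs. f q :: 'a :: monoid_add) = 0"
  by (induction qs) auto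

lemma f13_bracket_filtration:
  assumes "x \<in> f13_filtration m" "y \<in> f13_filtration n"
  shows "f13_bracket x y \<in> f13_filtration (m + n + 1)"
proof -
  have "coord (f13_bracket x y) k = 0" if k: "k < 13" "k < m + n + 1" for k
  proof -
    have zero: "(coord x (fst (fst q)) * coord y (snd (fst q)) -
        coord x (snd (fst q)) * coord y (fst (fst q))) * coord (snd q) k = 0"
      if q: "q \<in> set f13_brackets" for q
    proof (cases "k \<le> fst (fst q) + snd (fst q)")
      case True
      then show ?thesis
        using f13_brackets_degree(3)[OF q] k by simp
    next
      case False
      then have "fst (fst q) < m \<or> snd (fst q) < n" "snd (fst q) < m \<or> fst (fst q) < n"
        using k by linarith+
      then have "coord x (fst (fst q)) * coord y (snd (fst q)) = 0"
        "coord x (snd (fst q)) * coord y (fst (fst q)) = 0"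
        using f13_filtrationD[OF assms(1)] f13_filtrationD[OF assms(2)] f13_brackets_degree(1,2)[OF q]
        by auto
      then show ?thesis by (simp only: diff_self mult_zero_left)
    qed
    have "coord (f13_bracket x y) k = (\<Sum>q\<leftarrow>f13_brackets. (coord x (fst (fst q)) * coord y (snd (fst q)) -
        coord x (snd (fst q)) * coord y (fst (fst q))) * coord (snd q) k)"
      by (simp add: f13_bracket_eq_sum_list coord_sum_list o_def case_prod_unfold left_diff_distrib)
    then show ?thesis
      using sum_list_eq_zero[OF zero] by (simp only:)
  qed
  then show ?thesis
    by (simp add: f13_filtration_def)
qed

text \<open>
If \<open>[u, e\<^sub>k]\<close> has a nonzero leading coefficient for all \<open>k \<ge> n\<close>, then the equation \<open>[u, y] = x\<close> is a
triangular system and can be solved for \<open>y\<close> from the lowest coordinate upwards. This lets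
derivations be controlled deep in the filtration by their behaviour higher up.
\<close>

lemma filtration_subset_bracket_image:
  assumes u: "u \<in> f13_filtration s"
    and lead: "\<And>k. n \<le> k \<Longrightarrow> k + s + 1 < 13 \<Longrightarrow> coord (f13_bracket u (f13_e k)) (k + s + 1) \<noteq> 0"
    and "x \<in> f13_filtration (k + s + 1)" "n \<le> k"
  shows "\<exists>y\<in>f13_filtration k. x = f13_bracket u y"
  using assms(3,4)
proof (induction "13 - k" arbitrary: k x rule: less_induct)
  case less
  show ?case
  proof (cases "k + s + 1 < 13")
    case False
    then have "x = f13_bracket u 0"
      using less.prems f13_filtration_eq_0[of "k + s + 1"] f13_bracket_scale_right[of u 0 0] by simp
    then show ?thesis
      using vec.subspace_0[OF subspace_f13_filtration] by blast
  next
    case True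
    let ?b = "f13_bracket u (f13_e k)"
    define c where "c = coord x (k + s + 1) / coord ?b (k + s + 1)"
    have "?b \<in> f13_filtration (k + s + 1)"
      using f13_bracket_filtration[OF u basis_in_filtration[of k k]] True by (simp add: add.commute)
    then have "x - c *s ?b \<in> f13_filtration (Suc k + s + 1)"
      using less.prems(1) lead[OF less.prems(2) True]
      by (auto simp: f13_filtration_def less_Suc_eq c_def)
    moreover have "13 - Suc k < 13 - k"
      using True by simp
    ultimately obtain y where y: "y \<in> f13_filtration (Suc k)" "x - c *s ?b = f13_bracket u y"
      using less.hyps[of "Suc k" "x - c *s ?b"] less.prems(2) by (meson le_SucI)
    have "x = f13_bracket u (c *s f13_e k + y)"
      using y(2) by (simp add: f13_bracket_add_right f13_bracket_scale_right algebra_simps)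
    moreover have "c *s f13_e k + y \<in> f13_filtration k"
      using y(1) True f13_filtration_antimono[of k "Suc k"] subspace_f13_filtration[of k] basis_in_filtration[of k k]
      by (auto intro!: vec.subspace_add vec.subspace_scale)
    ultimately show ?thesis by blast
  qed
qed

lemma nilpotent_f13: "nilpotent_lie_algebra (*s) f13_bracket UNIV"
proof -
  have sub: "lower_central_series (*s) f13_bracket UNIV k \<subseteq> f13_filtration k" for k
  proof (induction k)
    case (Suc k)
    have "f13_bracket x y \<in> f13_filtration (Suc k)" if "y \<in> f13_filtration k" for x y
      using f13_bracket_filtration[of x 0 y k] that by (simp add: f13_filtration_0)
    with Suc show ?case
      unfolding lower_central_series.simps
      by (intro vec.span_minimal subspace_f13_filtration) auto
  qed (simp add: f13_filtration_0)
  have "vec.subspace (lower_central_series (*s) f13_bracket UNIV k)" for k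
    by (cases k) auto
  then have "lower_central_series (*s) f13_bracket UNIV 13 = {0}"
    using sub[of 13] vec.subspace_0 by (auto simp: f13_filtration_eq_0)
  then show ?thesis
    using lie_algebra_f13 unfolding nilpotent_lie_algebra_def by blast
qed

section \<open>Ideals of codimension 1\<close>

lemma in_subspace_of_scale:
  "vec.subspace S \<Longrightarrow> c *s x \<in> S \<Longrightarrow> c \<noteq> 0 \<Longrightarrow> x \<in> S"
  using vec.subspace_scale[of S "c *s x" "1 / c"] by simp

text \<open>
The ideal contains all brackets \<open>[e\<^sub>0, y]\<close>, and these exhaust \<open>F\<^sub>2\<close>. What is left is a line in the
plane spanned by \<open>e\<^sub>0\<close> and \<open>e\<^sub>1\<close>: either the line through \<open>e\<^sub>1\<close>, or the line through some
\<open>e\<^sub>0 + t e\<^sub>1\<close>.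
\<close>

lemma f13_codim_1_ideal_cases:
  assumes I: "lie_ideal (*s) f13_bracket UNIV I"
    and dim: "vec.dim (UNIV :: (complex ^ 13) set) = vec.dim I + 1"
  shows "I = {x. coord x 0 = 0} \<or> (\<exists>t. I = {x. coord x 1 = t * coord x 0})"
proof -
  have sub: "vec.subspace I"
    using I by (simp add: lie_ideal_def)
  have "I \<noteq> UNIV"
    using dim by auto
  then obtain u where u: "u \<notin> I"
    by blast
  have "vec.dim (insert u I) = vec.dim (UNIV :: (complex ^ 13) set)"
    using u sub dim by (simp add: vec.dim_insert vec.span_eq_iff[THEN iffD2])
  then have "vec.span (insert u I) = UNIV"
    by (metis vec.dim_eq_full vec.dim_UNIV vec.dimension_def)
  then have dec: "\<exists>y\<in>I. \<exists>c. x = y + c *s u" for x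
    using vec.span_breakdown_eq[of x u I] sub by (metis UNIV_I diff_add_cancel vec.span_eq_iff)
  have F2: "x \<in> I" if x: "x \<in> f13_filtration 2" for x
  proof -
    have "coord (f13_bracket (f13_e 0) (f13_e k)) (k + 0 + 1) \<noteq> 0" if "1 \<le> k" "k + 0 + 1 < 13" for k
    proof -
      have "k \<in> {1,2,3,4,5,6,7,8,9,10,11}" using that by simp presburger
      then show ?thesis
        by (auto simp: f13_bracket_basis f13_table_def f13_brackets_def coord_basis)
    qed
    from filtration_subset_bracket_image[of "f13_e 0" 0 1, OF _ this, of x 1]
    obtain y where "x = f13_bracket (f13_e 0) y"
      using x by (auto simp: f13_filtration_0 numeral_2_eq_2)
    then show ?thesis
      using bracket_in_codim_1_ideal[OF lie_algebra_f13 I dec] by simp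
  qed
  have split2: "x - coord x 0 *s f13_e 0 - coord x 1 *s f13_e 1 \<in> f13_filtration 2" for x
    by (auto simp: f13_filtration_def coord_basis less_Suc_eq numeral_2_eq_2)
  show ?thesis
  proof (cases "f13_e 1 \<in> I")
    case True
    have "coord x 0 = 0" if "x \<in> I" for x
    proof (rule ccontr)
      assume "coord x 0 \<noteq> 0"
      have "coord x 0 *s f13_e 0 = x - coord x 1 *s f13_e 1 - (x - coord x 0 *s f13_e 0 - coord x 1 *s f13_e 1)"
        by simp
      then have "coord x 0 *s f13_e 0 \<in> I"
        using that True F2[OF split2] sub by (metis vec.subspace_diff vec.subspace_scale)
      then have e0: "f13_e 0 \<in> I"
        using in_subspace_of_scale[OF sub] \<open>coord x 0 \<noteq> 0\<close> by blast
      have "u = coord u 0 *s f13_e 0 + coord u 1 *s f13_e 1 + (u - coord u 0 *s f13_e 0 - coord u 1 *s f13_e 1)"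
        by simp
      then have "u \<in> I"
        using e0 True F2[OF split2] sub by (metis vec.subspace_add vec.subspace_scale)
      with u show False by simp
    qed
    moreover have "x \<in> I" if "coord x 0 = 0" for x
    proof -
      have "x = coord x 1 *s f13_e 1 + (x - coord x 0 *s f13_e 0 - coord x 1 *s f13_e 1)"
        using that by simp
      then show ?thesis
        using True F2[OF split2] sub by (metis vec.subspace_add vec.subspace_scale)
    qed
    ultimately show ?thesis by blast
  next
    case False
    obtain y c where y: "y \<in> I" "f13_e 0 = y + c *s u" using dec by blast
    obtain z d where z: "z \<in> I" "f13_e 1 = z + d *s u" using dec by blast
    have d: "d \<noteq> 0"
      using z False by auto
    define t where "t = - c / d"
    define v where "v = f13_e 0 + t *s f13_e 1"
    have "t *s f13_e 1 = t *s z + (t * d) *s u"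
      by (simp only: z(2) vec.scale_right_distrib vec.scale_scale)
    then have "v = y + t *s z"
      using d by (simp add: v_def y(2) t_def)
    then have v: "v \<in> I"
      using y z sub by (simp add: vec.subspace_add vec.subspace_scale)
    have eq: "x = coord x 0 *s v + (coord x 1 - t * coord x 0) *s f13_e 1
        + (x - coord x 0 *s f13_e 0 - coord x 1 *s f13_e 1)" for x
      by (simp add: v_def vec.scale_right_distrib vec.scale_left_diff_distrib mult.commute)
    have "coord x 1 = t * coord x 0" if "x \<in> I" for x
    proof (rule ccontr)
      assume ne: "coord x 1 \<noteq> t * coord x 0"
      have "(coord x 1 - t * coord x 0) *s f13_e 1
          = x - coord x 0 *s v - (x - coord x 0 *s f13_e 0 - coord x 1 *s f13_e 1)"
        using eq[of x] by (simp add: algebra_simps)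
      then have "(coord x 1 - t * coord x 0) *s f13_e 1 \<in> I"
        using that v F2[OF split2] sub by (metis vec.subspace_diff vec.subspace_scale)
      then have "f13_e 1 \<in> I"
        using in_subspace_of_scale[OF sub] ne by (metis right_minus_eq)
      with False show False by simp
    qed
    moreover have "x \<in> I" if "coord x 1 = t * coord x 0" for x
      using eq[of x] v F2[OF split2[of x]] sub that
      by (metis add.right_neutral diff_self vec.scale_zero_left vec.subspace_add vec.subspace_scale)
    ultimately show ?thesis by blast
  qed
qed

section \<open>Derivations and the filtration\<close>

lemma filtration_Suc: "x \<in> f13_filtration k \<Longrightarrow> coord x k = 0 \<Longrightarrow> x \<in> f13_filtration (Suc k)"
  by (auto simp: f13_filtration_def less_Suc_eq)

lemma filtration_numeral_Suc:
  "x \<in> f13_filtration 2 \<Longrightarrow> coord x 2 = 0 \<Longrightarrow> x \<in> f13_filtration 3"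
  "x \<in> f13_filtration 3 \<Longrightarrow> coord x 3 = 0 \<Longrightarrow> x \<in> f13_filtration 4"
  using filtration_Suc[of x 2] filtration_Suc[of x 3] by simp_all

locale f13_ideal_derivation =
  fixes I :: "(complex ^ 13) set" and D :: "complex ^ 13 \<Rightarrow> complex ^ 13"
  assumes ideal: "lie_ideal (*s) f13_bracket UNIV I"
    and der: "derivation_on (*s) f13_bracket I D"
    and F2_subset: "f13_filtration 2 \<subseteq> I"
begin

lemma subspace_I: "vec.subspace I"
  using ideal by (simp add: lie_ideal_def)

lemma I_closed:
  "x \<in> I \<Longrightarrow> y \<in> I \<Longrightarrow> x + y \<in> I" "x \<in> I \<Longrightarrow> y \<in> I \<Longrightarrow> x - y \<in> I"
  "x \<in> I \<Longrightarrow> c *s x \<in> I" "y \<in> I \<Longrightarrow> f13_bracket x y \<in> I"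
  using subspace_I ideal
  by (simp_all add: vec.subspace_add vec.subspace_diff vec.subspace_scale lie_ideal_def)

lemma filtration_subset_I: "2 \<le> k \<Longrightarrow> x \<in> f13_filtration k \<Longrightarrow> x \<in> I"
  using F2_subset f13_filtration_antimono[of 2 k] by blast

lemma basis_in_I: "2 \<le> k \<Longrightarrow> k < 13 \<Longrightarrow> f13_e k \<in> I"
  using filtration_subset_I[of k] basis_in_filtration[of k k] by simp

lemma D_in_I: "x \<in> I \<Longrightarrow> D x \<in> I"
  and D_add: "x \<in> I \<Longrightarrow> y \<in> I \<Longrightarrow> D (x + y) = D x + D y"
  and D_scale: "x \<in> I \<Longrightarrow> D (c *s x) = c *s D x"
  and D_bracket: "x \<in> I \<Longrightarrow> y \<in> I \<Longrightarrow>
    D (f13_bracket x y) = f13_bracket (D x) y + f13_bracket x (D y)"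
  using der by (auto simp: derivation_on_def endomorphism_on_def)

lemma D_diff: "x \<in> I \<Longrightarrow> y \<in> I \<Longrightarrow> D (x - y) = D x - D y"
  using D_add[of "x - y" y] I_closed(2)[of x y] by (simp add: algebra_simps)

text \<open>
Suppose that \<open>D\<close> raises the filtration by \<open>r\<close> on \<open>F\<^sub>k\<close> and on \<open>u\<close>. Elements of \<open>F\<^sub>k\<^sub>+\<^sub>s\<^sub>+\<^sub>1\<close> are of the form
\<open>[u, y]\<close> with \<open>y \<in> F\<^sub>k\<close>, and \<open>D [u, y] = [D u, y] + [u, D y]\<close>, so \<open>D\<close> also raises the filtration by \<open>r\<close>
there. With \<open>r = 0\<close> this propagates that \<open>D\<close> preserves the filtration, with \<open>r = 1\<close> that it is
strictly triangular.
\<close>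

lemma D_image_filtration_bracket:
  assumes u: "u \<in> I" "u \<in> f13_filtration s" "D u \<in> f13_filtration (s + r)"
    and lead: "\<And>j. 2 \<le> j \<Longrightarrow> j + s + 1 < 13 \<Longrightarrow> coord (f13_bracket u (f13_e j)) (j + s + 1) \<noteq> 0"
    and D: "D ` f13_filtration k \<subseteq> f13_filtration (k + r)" and k: "2 \<le> k"
  shows "D ` f13_filtration (k + s + 1) \<subseteq> f13_filtration (k + s + 1 + r)"
proof
  fix z assume "z \<in> D ` f13_filtration (k + s + 1)"
  then obtain x where x: "x \<in> f13_filtration (k + s + 1)" "z = D x"
    by blast
  obtain y where y: "y \<in> f13_filtration k" "x = f13_bracket u y"
    using filtration_subset_bracket_image[OF u(2) lead x(1) k] by blast
  have "f13_bracket (D u) y \<in> f13_filtration (k + s + 1 + r)"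
    using f13_bracket_filtration[OF u(3) y(1)] by (simp add: ac_simps)
  moreover have "f13_bracket u (D y) \<in> f13_filtration (k + s + 1 + r)"
    using f13_bracket_filtration[OF u(2), of "D y" "k + r"] D y(1) by (auto simp: ac_simps)
  ultimately show "z \<in> f13_filtration (k + s + 1 + r)"
    using D_bracket[OF u(1) filtration_subset_I[OF k y(1)]] x(2) y(2)
      vec.subspace_add[OF subspace_f13_filtration] by simp
qed

lemma D_image_filtration_step:
  assumes "D (f13_e k) \<in> f13_filtration l" "D ` f13_filtration (Suc k) \<subseteq> f13_filtration l"
    "2 \<le> k" "k < 13"
  shows "D ` f13_filtration k \<subseteq> f13_filtration l"
proof
  fix z assume "z \<in> D ` f13_filtration k"
  then obtain x where x: "x \<in> f13_filtration k" "z = D x" by blast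
  let ?y = "x - coord x k *s f13_e k"
  have y: "?y \<in> f13_filtration (Suc k)"
    using filtration_minus_leading[OF x(1) assms(4)] .
  have "z = coord x k *s D (f13_e k) + D ?y"
    using x D_add[of "coord x k *s f13_e k" ?y] D_scale basis_in_I[OF assms(3,4)]
      filtration_subset_I[OF _ y] assms(3) I_closed(3) by simp
  then show "z \<in> f13_filtration l"
    using assms(1,2) y vec.subspace_add[OF subspace_f13_filtration] vec.subspace_scale[OF subspace_f13_filtration]
    by auto
qed

lemma D_image_I:
  assumes "u \<in> I" "D u \<in> f13_filtration 2" "D ` f13_filtration 2 \<subseteq> f13_filtration 2"
    "\<And>x. x \<in> I \<Longrightarrow> \<exists>c. x - c *s u \<in> f13_filtration 2"
  shows "D ` I \<subseteq> f13_filtration 2"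
proof
  fix z assume "z \<in> D ` I"
  then obtain x where x: "x \<in> I" "z = D x" by blast
  then obtain c where c: "x - c *s u \<in> f13_filtration 2"
    using assms(4) by blast
  have "z = c *s D u + D (x - c *s u)"
    using x assms(1) by (simp add: D_diff D_scale I_closed)
  then show "z \<in> f13_filtration 2"
    using assms(2,3) c vec.subspace_add[OF subspace_f13_filtration] vec.subspace_scale[OF subspace_f13_filtration]
    by auto
qed

lemma nilpotent_if_shifts:
  assumes "D ` I \<subseteq> f13_filtration 2"
    "\<And>k. 2 \<le> k \<Longrightarrow> D ` f13_filtration k \<subseteq> f13_filtration (k + 1)"
    "x \<in> I"
  shows "(D ^^ 12) x = 0"
proof -
  have "(D ^^ Suc n) x \<in> f13_filtration (n + 2)" for n
  proof (induction n)
    case (Suc n)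
    then show ?case
      using assms(2)[of "n + 2"] by auto
  qed (use assms in \<open>auto simp: numeral_2_eq_2\<close>)
  from this[of 11] show ?thesis
    by (simp add: f13_filtration_eq_0 del: funpow.simps)
qed

end

section \<open>Ideals spanned by \<open>e\<^sub>0 + t e\<^sub>1\<close> and \<open>F\<^sub>2\<close>\<close>

text \<open>
Below, the coefficients of \<open>D e\<^sub>1\<close> and \<open>D e\<^sub>2\<close> at \<open>e\<^sub>3\<close> arise with index \<open>1 + 2\<close> and \<open>2 + 1\<close>, which
rewriting can turn into iterated successors.
\<close>

lemma coord_Suc_Suc_Suc_0: "coord x (Suc (Suc (Suc 0))) = coord x 3"
  by (simp add: numeral_3_eq_3)

lemmas f13_table_simps = f13_bracket_basis f13_table_def f13_brackets_def coord_basis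

text \<open>
The notation is \<open>D v = \<alpha> v + \<dots>\<close> and \<open>D e\<^sub>j = \<delta>\<^sub>j e\<^sub>j + \<eta>\<^sub>j e\<^sub>j\<^sub>+\<^sub>1 + \<epsilon>\<^sub>j e\<^sub>j\<^sub>+\<^sub>2 + \<dots>\<close>, so \<open>\<delta>\<close>, \<open>\<eta>\<close>, \<open>\<epsilon>\<close> are the parts of
\<open>D\<close> of degree 0, 1, 2. Applying \<open>D\<close> to \<open>[v, e\<^sub>j]\<close> gives recursions in \<open>j\<close> for each of them, and
\<open>[e\<^sub>2, e\<^sub>3]\<close> gives a further relation. In degree 0 the outcome is that \<open>\<delta>\<^sub>j\<close> is \<open>\<alpha>\<close> times the degree of
\<open>e\<^sub>j\<close>. In degree 1 the recursion contributes a multiple of \<open>t \<alpha>\<close> at each step while \<open>[e\<^sub>2, e\<^sub>3]\<close> forces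
\<open>\<eta>\<^sub>6 = \<eta>\<^sub>3\<close>, hence \<open>t \<alpha> = 0\<close>. If \<open>t = 0\<close>, then \<open>[e\<^sub>2, e\<^sub>3]\<close> and \<open>[e\<^sub>2, e\<^sub>5]\<close> give in degree 2 two
different multiples of \<open>\<alpha>\<close> for the same quantity.
\<close>

lemma derivation_nilpotent_with_e0:
  assumes der: "derivation_on (*s) f13_bracket I D"
    and ideal: "lie_ideal (*s) f13_bracket UNIV I"
    and I: "I = {x. coord x 1 = t * coord x 0}" and x: "x \<in> I"
  shows "(D ^^ 12) x = 0"
proof -
  interpret f13_ideal_derivation I D
    by unfold_locales (use der ideal I in \<open>auto simp: f13_filtration_def\<close>)
  define v where "v = f13_e 0 + t *s f13_e 1"
  have v: "v \<in> I"
    by (simp add: I v_def coord_basis)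
  define \<alpha> where "\<alpha> = coord (D v) 0"
  have Dv: "coord (D v) 0 = \<alpha>" "coord (D v) 1 = t * \<alpha>"
    using D_in_I[OF v] by (simp_all add: I \<alpha>_def)
  have lead: "coord (f13_bracket v (f13_e j)) (j + 0 + 1) \<noteq> 0" if "2 \<le> j" "j + 0 + 1 < 13" for j
  proof -
    have "j \<in> {2,3,4,5,6,7,8,9,10,11}" using that by simp presburger
    then show ?thesis
      by (auto simp: v_def f13_bracket_add_left f13_bracket_scale_left f13_table_simps)
  qed
  \<comment> \<open>The coordinate \<open>x\<^sub>0 y\<^sub>1 - x\<^sub>1 y\<^sub>0\<close> of \<open>e\<^sub>2\<close> vanishes because \<open>x\<close> and \<open>y\<close> are proportional modulo \<open>F\<^sub>2\<close>.\<close>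
  have bI: "f13_bracket x y \<in> f13_filtration 3" if "x \<in> I" "y \<in> I" for x y
  proof -
    have "coord (f13_bracket x y) i = 0" if "i < 3" for i
    proof -
      have "i = 0 \<or> i = 1 \<or> i = 2" using that by arith
      then show ?thesis
        using \<open>x \<in> I\<close> \<open>y \<in> I\<close> by (elim disjE; simp only: I mem_Collect_eq coord_f13_bracket; simp)
    qed
    then show ?thesis
      by (simp add: f13_filtration_def)
  qed
  have F3: "D ` f13_filtration 3 \<subseteq> f13_filtration 3"
  proof
    fix z assume "z \<in> D ` f13_filtration 3"
    then obtain x where x: "x \<in> f13_filtration 3" "z = D x" by blast
    obtain y where y: "y \<in> f13_filtration 2" "x = f13_bracket v y"
      using filtration_subset_bracket_image[of v 0 2 x 2, OF _ lead] x(1) by (auto simp: f13_filtration_0)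
    then show "z \<in> f13_filtration 3"
      using D_bracket[OF v, of y] filtration_subset_I[of 2 y] bI v D_in_I x(2)
        vec.subspace_add[OF subspace_f13_filtration] by simp
  qed
  have shift0: "D ` f13_filtration k \<subseteq> f13_filtration k" if "3 \<le> k" for k
    using that
  proof (induction k rule: dec_induct)
    case (step k)
    then show ?case
      using D_image_filtration_bracket[of v 0 0 k] v lead by (simp add: f13_filtration_0)
  qed (rule F3)
  have d: "coord (D (f13_e j)) i = 0" if "3 \<le> j" "j < 13" "i < j" for i j
    using shift0[OF that(1)] basis_in_filtration[of j j] that f13_filtrationD[of "D (f13_e j)" j i]
    by auto
  have e23: "D (f13_bracket (f13_e 2) (f13_e 3)) = (1/10) *s D (f13_e 6) + D (f13_e 8)"
    by (simp add: f13_table_simps D_add D_scale basis_in_I I_closed)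
  have E23: "coord (f13_bracket (D (f13_e 2)) (f13_e 3) + f13_bracket (f13_e 2) (D (f13_e 3))) i
     = (1/10) * coord (D (f13_e 6)) i + coord (D (f13_e 8)) i" for i
    using arg_cong[OF e23, of "\<lambda>x. coord x i"] by (simp add: D_bracket basis_in_I)
  \<comment> \<open>If \<open>D e\<^sub>2\<close> involved \<open>v\<close>, then \<open>[D e\<^sub>2, e\<^sub>3]\<close> would involve \<open>e\<^sub>4\<close>, but \<open>D [e\<^sub>2, e\<^sub>3]\<close> lies in \<open>F\<^sub>6\<close>.\<close>
  have "coord (D (f13_e 2)) 0 = 0"
    using E23[of 4] by (simp add: d coord_f13_bracket coord_basis)
  then have De2: "coord (D (f13_e 2)) 0 = 0" "coord (D (f13_e 2)) (Suc 0) = 0"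
    using D_in_I[of "f13_e 2"] basis_in_I by (simp_all add: I)
  have ev: "D (f13_bracket v (f13_e 2)) = D (f13_e 3) + t *s D (f13_e 4)"
    "D (f13_bracket v (f13_e 3)) = D (f13_e 4) + t *s D (f13_e 5)"
    "D (f13_bracket v (f13_e 4)) = D (f13_e 5) + t *s ((9/10) *s D (f13_e 6) - D (f13_e 8))"
    "D (f13_bracket v (f13_e 5)) = D (f13_e 6) + t *s ((4/5) *s D (f13_e 7) - 2 *s D (f13_e 9))"
    "D (f13_bracket v (f13_e 6)) = D (f13_e 7) + t *s ((5/7) *s D (f13_e 8)
        - (335/126) *s D (f13_e 10) + (22105/15246) *s D (f13_e 12))"
    "D (f13_bracket v (f13_e 7)) = D (f13_e 8) + t *s ((9/14) *s D (f13_e 9)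
        - (125/42) *s D (f13_e 11))"
    "D (f13_bracket v (f13_e 8)) = D (f13_e 9) + t *s ((7/12) *s D (f13_e 10)
        - (4421/1452) *s D (f13_e 12))"
    "D (f13_bracket v (f13_e 9)) = D (f13_e 10) + t *s ((8/15) *s D (f13_e 11))"
    by (simp_all add: v_def f13_bracket_add_left f13_bracket_scale_left f13_table_simps
        D_add D_scale D_diff basis_in_I I_closed)
  have e25: "D (f13_bracket (f13_e 2) (f13_e 5)) = (3/35) *s D (f13_e 8) + (83/126) *s D (f13_e 10)
      - (22105/15246) *s D (f13_e 12)"
    by (simp add: f13_table_simps D_add D_scale D_diff basis_in_I I_closed)
  have E25: "coord (f13_bracket (D (f13_e 2)) (f13_e 5) + f13_bracket (f13_e 2) (D (f13_e 5))) i
     = (3/35) * coord (D (f13_e 8)) i + (83/126) * coord (D (f13_e 10)) i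
      - (22105/15246) * coord (D (f13_e 12)) i" for i
    using arg_cong[OF e25, of "\<lambda>x. coord x i"] by (simp add: D_bracket basis_in_I)
  have Ev: "coord (f13_bracket (D v) (f13_e j) + f13_bracket v (D (f13_e j))) i =
      coord (D (f13_bracket v (f13_e j))) i" if "2 \<le> j" "j < 13" for i j
    using that by (simp add: D_bracket basis_in_I v)
  have cv: "coord v i = (if i = 0 then 1 else if i = Suc 0 then t else 0)" if "i < 13" for i
    using that by (simp add: v_def coord_basis)
  note cs = coord_Suc_Suc_Suc_0 d De2 Dv[unfolded One_nat_def] coord_f13_bracket coord_basis cv
  define \<delta> \<eta> \<epsilon> where "\<delta> j = coord (D (f13_e j)) j" and "\<eta> j = coord (D (f13_e j)) (j + 1)"
    and "\<epsilon> j = coord (D (f13_e j)) (j + 2)" for j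
  have \<delta>: "\<delta> 3 = \<alpha> + \<delta> 2" "\<delta> 4 = \<alpha> + \<delta> 3" "\<delta> 5 = \<alpha> + \<delta> 4" "\<delta> 6 = \<alpha> + \<delta> 5"
    "\<delta> 7 = \<alpha> + \<delta> 6" "\<delta> 8 = \<alpha> + \<delta> 7" "\<delta> 9 = \<alpha> + \<delta> 8" "\<delta> 10 = \<alpha> + \<delta> 9" "\<delta> 6 = \<delta> 2 + \<delta> 3"
    using Ev[of 2 3] Ev[of 3 4] Ev[of 4 5] Ev[of 5 6] Ev[of 6 7] Ev[of 7 8] Ev[of 8 9] Ev[of 9 10] E23[of 6]
    by (simp_all add: cs ev \<delta>_def)
  then have \<delta>2: "\<delta> 2 = 3 * \<alpha>"
    by algebra
  \<comment> \<open>Degree 1: the coefficients at \<open>e\<^sub>j\<^sub>+\<^sub>2\<close> of \<open>D [v, e\<^sub>j]\<close> and at \<open>e\<^sub>7\<close> of \<open>D [e\<^sub>2, e\<^sub>3]\<close>.\<close>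
  have "\<eta> 3 + t * \<delta> 4 = t * \<alpha> + \<eta> 2 + t * \<delta> 2"
    using Ev[of 2 4] by (simp add: cs ev \<delta>_def \<eta>_def algebra_simps)
  moreover have "\<eta> 4 + t * \<delta> 5 = t * \<alpha> + \<eta> 3 + t * \<delta> 3"
    using Ev[of 3 5] by (simp add: cs ev \<delta>_def \<eta>_def algebra_simps)
  moreover have "\<eta> 5 + (9/10) * t * \<delta> 6 = (9/10) * t * \<alpha> + \<eta> 4 + (9/10) * t * \<delta> 4"
    using Ev[of 4 6] by (simp add: cs ev \<delta>_def \<eta>_def) algebra
  moreover have "\<eta> 6 + (4/5) * t * \<delta> 7 = (4/5) * t * \<alpha> + \<eta> 5 + (4/5) * t * \<delta> 5"
    using Ev[of 5 7] by (simp add: cs ev \<delta>_def \<eta>_def) algebra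
  moreover have "\<eta> 6 = \<eta> 3"
    using E23[of 7] by (simp add: cs ev \<delta>_def \<eta>_def)
  ultimately have "t * \<alpha> = 0"
    using \<delta> by algebra
  moreover have "\<alpha> = 0" if t: "t = 0"
  proof -
    \<comment> \<open>Degree 2: the coefficients at \<open>e\<^sub>j\<^sub>+\<^sub>3\<close> of \<open>D [e\<^sub>0, e\<^sub>j]\<close>, at \<open>e\<^sub>8\<close> of \<open>D [e\<^sub>2, e\<^sub>3]\<close>
      and at \<open>e\<^sub>1\<^sub>0\<close> of \<open>D [e\<^sub>2, e\<^sub>5]\<close>.\<close>
    define a where "a = coord (D v) 2"
    have \<epsilon>3: "\<epsilon> 3 = \<epsilon> 2"
      using Ev[of 2 5] by (simp add: cs ev t \<epsilon>_def)
    have \<epsilon>4: "\<epsilon> 4 = a / 10 + \<epsilon> 3"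
      using Ev[of 3 6] by (simp add: cs ev t \<epsilon>_def a_def)
    have \<epsilon>5: "\<epsilon> 5 = a / 10 + \<epsilon> 4"
      using Ev[of 4 7] by (simp add: cs ev t \<epsilon>_def a_def)
    have \<epsilon>6: "\<epsilon> 6 = (3/35) * a + \<epsilon> 5"
      using Ev[of 5 8] by (simp add: cs ev t \<epsilon>_def a_def)
    have \<epsilon>7: "\<epsilon> 7 = (1/14) * a + \<epsilon> 6"
      using Ev[of 6 9] by (simp add: cs ev t \<epsilon>_def a_def)
    have \<epsilon>8: "\<epsilon> 8 = (5/84) * a + \<epsilon> 7"
      using Ev[of 7 10] by (simp add: cs ev t \<epsilon>_def a_def)
    note \<epsilon> = \<epsilon>8 \<epsilon>7 \<epsilon>6 \<epsilon>5 \<epsilon>4 \<epsilon>3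
    have \<delta>': "\<delta> 3 = 4 * \<alpha>" "\<delta> 5 = 6 * \<alpha>" "\<delta> 8 = 9 * \<alpha>" "\<delta> 10 = 11 * \<alpha>"
      using \<delta>(1-8) \<delta>2 by simp_all
    \<comment> \<open>Both relations turn out to involve only \<open>\<epsilon>\<^sub>2 + a\<close>, with incompatible multiples of \<open>\<alpha>\<close>.\<close>
    have "(1/10) * \<epsilon> 6 + \<delta> 8 = (3/35) * \<epsilon> 3 - (1/70) * \<epsilon> 2 + \<delta> 2 + \<delta> 3"
      using E23[of 8] by (simp add: cs \<delta>_def \<epsilon>_def) algebra
    then have "\<epsilon> 2 + a = - 70 * \<alpha>"
      unfolding \<epsilon> \<delta>' \<delta>2 by (simp add: complex_eq_iff field_simps)
    moreover have "(3/35) * \<epsilon> 8 + (83/126) * \<delta> 10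
        = (5/84) * \<epsilon> 5 + (1/420) * \<epsilon> 2 + (83/126) * (\<delta> 2 + \<delta> 5)"
      using E25[of 10] by (simp add: cs \<delta>_def \<epsilon>_def) algebra
    then have "(1/42) * (\<epsilon> 2 + a) = - (83/63) * \<alpha>"
      unfolding \<epsilon> \<delta>' \<delta>2 by (simp add: complex_eq_iff field_simps)
    ultimately show ?thesis
      by (simp add: complex_eq_iff field_simps)
  qed
  ultimately have \<alpha>: "\<alpha> = 0"
    by auto
  have "D (f13_e 2) \<in> f13_filtration 3"
  proof -
    have "coord (D (f13_e 2)) 2 = 0"
      using \<delta>2 \<alpha> by (simp add: \<delta>_def)
    with De2 show ?thesis
      by (auto simp: f13_filtration_def less_Suc_eq numeral_3_eq_3 numeral_2_eq_2)
  qed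
  moreover have "D ` f13_filtration (Suc 2) \<subseteq> f13_filtration 3"
    using F3 by (simp add: numeral_3_eq_3 numeral_2_eq_2)
  ultimately have F2: "D ` f13_filtration 2 \<subseteq> f13_filtration 3"
    by (rule D_image_filtration_step) simp_all
  have Dv1: "D v \<in> f13_filtration 2"
    using Dv \<alpha> by (auto simp: f13_filtration_def less_Suc_eq numeral_2_eq_2)
  show ?thesis
  proof (rule nilpotent_if_shifts[OF _ _ x])
    show "D ` f13_filtration k \<subseteq> f13_filtration (k + 1)" if "2 \<le> k" for k
      using that
    proof (induction k rule: dec_induct)
      case (step k)
      then show ?case
        using D_image_filtration_bracket[of v 0 1 k] v lead Dv1 f13_filtration_antimono[of 1 2] by (auto simp: f13_filtration_0)
    qed (use F2 in simp)
    have "x - coord x 0 *s v \<in> f13_filtration 2" if "x \<in> I" for x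
      using that cv by (auto simp: I f13_filtration_def less_Suc_eq numeral_2_eq_2)
    moreover have "D ` f13_filtration 2 \<subseteq> f13_filtration 2"
      using F2 f13_filtration_antimono[of 2 3] by auto
    ultimately show "D ` I \<subseteq> f13_filtration 2"
      using D_image_I[OF v Dv1] by blast
  qed
qed

section \<open>The ideal spanned by \<open>e\<^sub>1, \<dots>, e\<^sub>1\<^sub>2\<close>\<close>

text \<open>
Here \<open>e\<^sub>1\<close>, \<open>e\<^sub>2\<close>, \<open>e\<^sub>3\<close> generate the ideal, and \<open>[e\<^sub>1, \<cdot>]\<close> moves the filtration by two steps, so that
\<open>F\<^sub>2\<close> and \<open>F\<^sub>3\<close> both have to be treated before induction reaches the rest. Again
\<open>D e\<^sub>j = \<delta>\<^sub>j e\<^sub>j + \<dots> + \<epsilon>\<^sub>j e\<^sub>j\<^sub>+\<^sub>2 + \<dots>\<close>. In degree 0 all \<open>\<delta>\<^sub>j\<close> are multiples of \<open>\<delta>\<^sub>1\<close>, proportional to the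
degrees. Since the bracket has no part that raises the degree by 1, the obstruction appears only in
degree 2: comparing the two expressions for \<open>\<epsilon>\<^sub>6\<close>, the two for \<open>\<epsilon>\<^sub>7\<close> and the two for \<open>\<epsilon>\<^sub>8\<close> leaves
\<open>\<delta>\<^sub>1 = 0\<close>.
\<close>

lemma derivation_nilpotent_without_e0:
  assumes der: "derivation_on (*s) f13_bracket I D"
    and ideal: "lie_ideal (*s) f13_bracket UNIV I"
    and I: "I = {x. coord x 0 = 0}" and x: "x \<in> I"
  shows "(D ^^ 12) x = 0"
proof -
  interpret f13_ideal_derivation I D
    by unfold_locales (use der ideal I in \<open>auto simp: f13_filtration_def\<close>)
  have e1: "f13_e 1 \<in> I" "f13_e 1 \<in> f13_filtration 1"
    by (simp_all add: I coord_basis basis_in_filtration)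
  have "x \<in> f13_filtration 1" if "x \<in> I" for x
    using that by (simp add: I f13_filtration_def)
  then have D1: "D (f13_e 1) \<in> f13_filtration 1"
    using D_in_I e1(1) by blast
  have lead: "coord (f13_bracket (f13_e 1) (f13_e j)) (j + 1 + 1) \<noteq> 0" if "2 \<le> j" "j + 1 + 1 < 13" for j
  proof -
    have "j \<in> {2,3,4,5,6,7,8,9,10}" using that by simp presburger
    then show ?thesis
      by (auto simp: f13_table_simps)
  qed
  \<comment> \<open>The coordinates of \<open>e\<^sub>2\<close> and \<open>e\<^sub>3\<close> in a bracket involve the coordinate of \<open>e\<^sub>0\<close>, which is zero on \<open>I\<close>.\<close>
  have bI: "f13_bracket x y \<in> f13_filtration 4" if "x \<in> I" "y \<in> I" for x y
  proof -
    have "coord (f13_bracket x y) i = 0" if "i < 4" for i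
    proof -
      have "i = 0 \<or> i = 1 \<or> i = 2 \<or> i = 3" using that by arith
      then show ?thesis
        using \<open>x \<in> I\<close> \<open>y \<in> I\<close> by (elim disjE; simp only: I mem_Collect_eq coord_f13_bracket; simp)
    qed
    then show ?thesis
      by (simp add: f13_filtration_def)
  qed
  have F4: "D ` f13_filtration 4 \<subseteq> f13_filtration 4"
  proof
    fix z assume "z \<in> D ` f13_filtration 4"
    then obtain x where x: "x \<in> f13_filtration 4" "z = D x" by blast
    obtain y where y: "y \<in> f13_filtration 2" "x = f13_bracket (f13_e 1) y"
      using filtration_subset_bracket_image[of "f13_e 1" 1 2 x 2, OF e1(2) lead] x(1) by auto
    then show "z \<in> f13_filtration 4"
      using D_bracket[OF e1(1), of y] filtration_subset_I[of 2 y] bI e1(1) D_in_I x(2)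
        vec.subspace_add[OF subspace_f13_filtration] by simp
  qed
  have shift: "D ` f13_filtration (k + 2) \<subseteq> f13_filtration (k + 2)"
    if "D ` f13_filtration k \<subseteq> f13_filtration k" "2 \<le> k" for k
    using D_image_filtration_bracket[of "f13_e 1" 1 0 k] e1 D1 lead that by simp
  \<comment> \<open>Without control on \<open>F\<^sub>3\<close> only even steps of the filtration are available so far.\<close>
  have F6: "D ` f13_filtration 6 \<subseteq> f13_filtration 6" and F8: "D ` f13_filtration 8 \<subseteq> f13_filtration 8"
    using shift[of 4] shift[of 6] F4 by simp_all
  have brackets:
    "D (f13_bracket (f13_e 1) (f13_e 2)) = D (f13_e 4)"
    "D (f13_bracket (f13_e 1) (f13_e 3)) = D (f13_e 5)"
    "D (f13_bracket (f13_e 1) (f13_e 4)) = (9/10) *s D (f13_e 6) - D (f13_e 8)"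
    "D (f13_bracket (f13_e 1) (f13_e 5)) = (4/5) *s D (f13_e 7) - 2 *s D (f13_e 9)"
    "D (f13_bracket (f13_e 1) (f13_e 6)) = (5/7) *s D (f13_e 8) - (335/126) *s D (f13_e 10)
       + (22105/15246) *s D (f13_e 12)"
    "D (f13_bracket (f13_e 1) (f13_e 7)) = (9/14) *s D (f13_e 9) - (125/42) *s D (f13_e 11)"
    "D (f13_bracket (f13_e 1) (f13_e 8)) = (7/12) *s D (f13_e 10) - (4421/1452) *s D (f13_e 12)"
    "D (f13_bracket (f13_e 2) (f13_e 3)) = (1/10) *s D (f13_e 6) + D (f13_e 8)"
    "D (f13_bracket (f13_e 2) (f13_e 4)) = (1/10) *s D (f13_e 7) + D (f13_e 9)"
    "D (f13_bracket (f13_e 2) (f13_e 5)) = (3/35) *s D (f13_e 8) + (83/126) *s D (f13_e 10)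
       - (22105/15246) *s D (f13_e 12)"
    by (simp_all add: f13_table_simps D_add D_scale D_diff basis_in_I I_closed)
  have E: "coord (f13_bracket (D (f13_e i)) (f13_e j) + f13_bracket (f13_e i) (D (f13_e j))) k =
      coord (D (f13_bracket (f13_e i) (f13_e j))) k" if "1 \<le> i" "1 \<le> j" "i < 13" "j < 13" for i j k
    using that D_bracket[of "f13_e i" "f13_e j"] by (simp add: I coord_basis)
  have dI: "coord (D (f13_e j)) 0 = 0" if "1 \<le> j" "j < 13" for j
    using D_in_I[of "f13_e j"] that by (simp add: I coord_basis)
  have dF: "coord (D (f13_e j)) i = 0"
    if "D ` f13_filtration k \<subseteq> f13_filtration k" "k \<le> j" "i < k" "j < 13" for i j k
    using that basis_in_filtration[of j k] f13_filtrationD[of "D (f13_e j)" k i] by auto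
  note cs0 = dI dF[OF F4] dF[OF F6] dF[OF F8] coord_f13_bracket coord_basis brackets brackets[unfolded One_nat_def]
  \<comment> \<open>It remains to exclude \<open>e\<^sub>1\<close> from \<open>D e\<^sub>2\<close> and \<open>e\<^sub>1\<close>, \<open>e\<^sub>2\<close> from \<open>D e\<^sub>3\<close>. The first two follow
      as \<open>D [e\<^sub>2, e\<^sub>3]\<close> lies in \<open>F\<^sub>6\<close>; the last one from \<open>D e\<^sub>5 = D [e\<^sub>1, e\<^sub>3]\<close>, once \<open>e\<^sub>4\<close> is excluded there.\<close>
  have r1: "coord (D (f13_e 3)) 1 = 0" and q1: "coord (D (f13_e 2)) 1 = 0"
    using E[of 2 3 4] E[of 2 3 5] by (simp_all add: cs0)
  have "coord (D (f13_e 7)) 6 = 0"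
    using E[of 2 4 6] q1 by (simp add: cs0)
  then have "coord (D (f13_e 5)) 4 = 0"
    using E[of 1 5 6] by (simp add: cs0)
  then have r2: "coord (D (f13_e 3)) 2 = 0"
    using E[of 1 3 4] r1 by (simp add: cs0)
  have F3: "D ` f13_filtration 3 \<subseteq> f13_filtration 3"
  proof (rule D_image_filtration_step)
    show "D (f13_e 3) \<in> f13_filtration 3"
      using r1 r2 dI[of 3] by (auto simp: f13_filtration_def less_Suc_eq numeral_3_eq_3 numeral_2_eq_2)
    show "D ` f13_filtration (Suc 3) \<subseteq> f13_filtration 3"
      using F4 f13_filtration_antimono[of 3 4] by simp
  qed simp_all
  have F2: "D ` f13_filtration 2 \<subseteq> f13_filtration 2"
  proof (rule D_image_filtration_step)
    show "D (f13_e 2) \<in> f13_filtration 2"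
      using q1 dI[of 2] by (auto simp: f13_filtration_def less_Suc_eq numeral_3_eq_3 numeral_2_eq_2)
    show "D ` f13_filtration (Suc 2) \<subseteq> f13_filtration 2"
      using F3 f13_filtration_antimono[of 2 3] by (simp add: numeral_3_eq_3 numeral_2_eq_2)
  qed simp_all
  have shift0: "D ` f13_filtration k \<subseteq> f13_filtration k" if "2 \<le> k" for k
    using that
  proof (induction k rule: less_induct)
    case (less k)
    then consider "k = 2" | "k = 3" | "k = k - 2 + 2" "2 \<le> k - 2" by linarith
    then show ?case
      using F2 F3 shift[of "k - 2"] less.IH[of "k - 2"] by cases auto
  qed
  have d: "coord (D (f13_e j)) i = 0" if "2 \<le> j" "i < j" "j < 13" for i j
    using dF[OF shift0[OF that(1)] order_refl] that by auto
  note cs = coord_Suc_Suc_Suc_0 d dI coord_f13_bracket coord_basis brackets brackets[unfolded One_nat_def]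
  define \<delta> \<epsilon> where "\<delta> j = coord (D (f13_e j)) j"
    and "\<epsilon> j = coord (D (f13_e j)) (j + 2)" for j
  \<comment> \<open>Degree 0: the coefficients at \<open>e\<^sub>i\<^sub>+\<^sub>j\<^sub>+\<^sub>1\<close> of \<open>D [e\<^sub>i, e\<^sub>j]\<close>.\<close>
  have \<delta>_sum: "\<delta> 4 = \<delta> 1 + \<delta> 2" "\<delta> 5 = \<delta> 1 + \<delta> 3" "\<delta> 6 = \<delta> 2 + \<delta> 3" "\<delta> 7 = \<delta> 2 + \<delta> 4"
    using E[of 1 2 4] E[of 1 3 5] E[of 2 3 6] E[of 2 4 7]
    by (simp_all add: cs \<delta>_def)
  have \<delta>6: "\<delta> 6 = \<delta> 1 + \<delta> 4"
    using E[of 1 4 6] by (simp add: cs \<delta>_def) algebra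
  have \<delta>7: "\<delta> 7 = \<delta> 1 + \<delta> 5"
    using E[of 1 5 7] by (simp add: cs \<delta>_def) algebra
  have \<delta>8: "\<delta> 8 = \<delta> 1 + \<delta> 6"
    using E[of 1 6 8] by (simp add: cs \<delta>_def) algebra
  have \<delta>9: "\<delta> 9 = \<delta> 1 + \<delta> 7"
    using E[of 1 7 9] by (simp add: cs \<delta>_def) algebra
  have \<delta>10: "\<delta> 10 = \<delta> 1 + \<delta> 8"
    using E[of 1 8 10] by (simp add: cs \<delta>_def) algebra
  have \<delta>3: "\<delta> 3 = 2 * \<delta> 1"
    using \<delta>6 \<delta>_sum by algebra
  have \<delta>2: "\<delta> 2 = (3/2) * \<delta> 1"
    using \<delta>7 \<delta>_sum \<delta>3 by algebra
  note \<delta> = \<delta>10 \<delta>9 \<delta>8 \<delta>7 \<delta>6 \<delta>_sum(1,2) \<delta>3 \<delta>2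
  \<comment> \<open>Degree 2: the coefficients at \<open>e\<^sub>i\<^sub>+\<^sub>j\<^sub>+\<^sub>3\<close> of \<open>D [e\<^sub>i, e\<^sub>j]\<close>.\<close>
  have \<epsilon>4: "\<epsilon> 4 = (9/10) * \<epsilon> 2 - (1/10) * \<epsilon> 1"
    using E[of 1 2 6] by (simp add: cs \<epsilon>_def)
  have \<epsilon>5: "\<epsilon> 5 = (4/5) * \<epsilon> 3"
    using E[of 1 3 7] by (simp add: cs \<epsilon>_def)
  have E148: "(9/10) * \<epsilon> 6 - \<delta> 8 = (1/70) * \<epsilon> 1 + (5/7) * \<epsilon> 4 - (\<delta> 1 + \<delta> 4)"
    using E[of 1 4 8] by (simp add: cs \<delta>_def \<epsilon>_def) algebra
  have E238: "(1/10) * \<epsilon> 6 + \<delta> 8 = (3/35) * \<epsilon> 3 - (1/70) * \<epsilon> 2 + \<delta> 2 + \<delta> 3"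
    using E[of 2 3 8] by (simp add: cs \<delta>_def \<epsilon>_def) algebra
  have E159: "(4/5) * \<epsilon> 7 - 2 * \<delta> 9 = (1/70) * \<epsilon> 1 + (9/14) * \<epsilon> 5 - 2 * (\<delta> 1 + \<delta> 5)"
    using E[of 1 5 9] by (simp add: cs \<delta>_def \<epsilon>_def) algebra
  have E249: "(1/10) * \<epsilon> 7 + \<delta> 9 = (1/14) * \<epsilon> 4 + \<delta> 2 + \<delta> 4"
    using E[of 2 4 9] by (simp add: cs \<delta>_def \<epsilon>_def) algebra
  \<comment> \<open>Eliminate \<open>\<epsilon>\<^sub>6\<close> between the first two relations and \<open>\<epsilon>\<^sub>7\<close> between the other two.\<close>
  have "27 * (\<epsilon> 2 - \<epsilon> 3) = 2 * \<epsilon> 1 - 350 * \<delta> 1"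
    using E148 E238 unfolding \<epsilon>4 \<epsilon>5 \<delta> by (simp add: complex_eq_iff field_simps)
  moreover have "36 * (\<epsilon> 2 - \<epsilon> 3) = 5 * \<epsilon> 1 + 700 * \<delta> 1"
    using E159 E249 unfolding \<epsilon>4 \<epsilon>5 \<delta> by (simp add: complex_eq_iff field_simps)
  ultimately have \<epsilon>1: "\<epsilon> 1 = - 500 * \<delta> 1" and \<epsilon>3: "\<epsilon> 3 = \<epsilon> 2 + 50 * \<delta> 1"
    by (simp_all add: complex_eq_iff field_simps)
  have \<epsilon>6: "\<epsilon> 6 = (5/7) * \<epsilon> 2 + (230/7) * \<delta> 1"
    using E148 unfolding \<epsilon>4 \<epsilon>1 \<delta> by (simp add: complex_eq_iff field_simps)
  \<comment> \<open>Now \<open>(3/35) \<epsilon>\<^sub>8\<close> can be computed from \<open>[e\<^sub>1, e\<^sub>6]\<close> and from \<open>[e\<^sub>2, e\<^sub>5]\<close>, with different results.\<close>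
  have "(5/7) * \<epsilon> 8 - (335/126) * \<delta> 10
      = (1/84) * \<epsilon> 1 + (7/12) * \<epsilon> 6 - (335/126) * (\<delta> 1 + \<delta> 6)"
    using E[of 1 6 10] by (simp add: cs \<delta>_def \<epsilon>_def) algebra
  then have "(3/35) * \<epsilon> 8 = (1/20) * \<epsilon> 2 + (40/21) * \<delta> 1"
    unfolding \<epsilon>1 \<epsilon>6 \<delta> by (simp add: complex_eq_iff field_simps)
  moreover have "(3/35) * \<epsilon> 8 + (83/126) * \<delta> 10
      = (1/420) * \<epsilon> 2 + (5/84) * \<epsilon> 5 + (83/126) * (\<delta> 2 + \<delta> 5)"
    using E[of 2 5 10] by (simp add: cs \<delta>_def \<epsilon>_def) algebra
  then have "(3/35) * \<epsilon> 8 = (1/20) * \<epsilon> 2 + (31/18) * \<delta> 1"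
    unfolding \<epsilon>5 \<epsilon>3 \<delta> by (simp add: complex_eq_iff field_simps)
  ultimately have "\<delta> 1 = 0"
    by (simp add: complex_eq_iff field_simps)
  then have De: "coord (D (f13_e 1)) 1 = 0" "coord (D (f13_e 2)) 2 = 0" "coord (D (f13_e 3)) 3 = 0"
    using \<delta>2 \<delta>3 by (simp_all add: \<delta>_def)
  have e1_shift: "D (f13_e 1) \<in> f13_filtration 2"
    using De(1) dI[of 1] by (auto simp: f13_filtration_def less_Suc_eq numeral_2_eq_2)
  have F3': "D ` f13_filtration 3 \<subseteq> f13_filtration 4"
  proof (rule D_image_filtration_step)
    show "D (f13_e 3) \<in> f13_filtration 4"
      using filtration_numeral_Suc(2)[OF _ De(3)] shift0[of 3] basis_in_filtration[of 3 3] by auto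
  qed (use F4 in simp_all)
  have F2': "D ` f13_filtration 2 \<subseteq> f13_filtration 3"
  proof (rule D_image_filtration_step)
    show "D (f13_e 2) \<in> f13_filtration 3"
      using filtration_numeral_Suc(1)[OF _ De(2)] F2 basis_in_filtration[of 2 2] by auto
  qed (use F3 in simp_all)
  show ?thesis
  proof (rule nilpotent_if_shifts[OF _ _ x])
    show "D ` f13_filtration k \<subseteq> f13_filtration (k + 1)" if "2 \<le> k" for k
      using that
    proof (induction k rule: less_induct)
      case (less k)
      then consider "k = 2" | "k = 3" | "k = k - 2 + 2" "2 \<le> k - 2" by linarith
      then show ?case
      proof cases
        case 3
        then obtain j where j: "k = j + 2" "2 \<le> j" by blast
        have "D ` f13_filtration (j + 1 + 1) \<subseteq> f13_filtration (j + 1 + 1 + 1)"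
          using e1_shift[unfolded numeral_2_eq_2] less.IH[of j] j e1 lead
          by (intro D_image_filtration_bracket[of "f13_e 1"]) simp_all
        then show ?thesis
          by (simp add: j)
      qed (use F2' F3' in simp_all)
    qed
    have "x - coord x 1 *s f13_e 1 \<in> f13_filtration 2" if "x \<in> I" for x
      using that by (auto simp: I f13_filtration_def less_Suc_eq coord_basis numeral_2_eq_2)
    then show "D ` I \<subseteq> f13_filtration 2"
      using D_image_I[OF e1(1) e1_shift F2] by blast
  qed
qed

section \<open>Strong characteristic nilpotency\<close>

theorem proposition2p5:
  shows "strong_characteristically_nilpotent (*s) f13_bracket (UNIV :: (complex ^ 13) set)"
  unfolding strong_characteristically_nilpotent_def
proof (intro conjI allI impI)
  show "nilpotent_lie_algebra (*s) f13_bracket UNIV"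
    by (rule nilpotent_f13)
  fix I :: "(complex ^ 13) set"
  assume I: "lie_ideal (*s) f13_bracket UNIV I \<and>
    vec.dim (UNIV :: (complex ^ 13) set) = vec.dim I + 1"
  have "D x = 0"
    if D: "derivation_on (*s) f13_bracket I D" "semisimple_on (*s) I D" and x: "x \<in> I" for D x
  proof (rule semisimple_nilpotent_eq_zero[OF vec.vector_space_axioms _ _ D(2) _ x])
    show "vec.subspace I"
      using I by (simp add: lie_ideal_def)
    show "endomorphism_on (*s) I D"
      using D(1) by (simp add: derivation_on_def)
    show "(D ^^ 12) y = 0" if "y \<in> I" for y
      using f13_codim_1_ideal_cases[of I] I derivation_nilpotent_with_e0[OF D(1) _ _ that]
        derivation_nilpotent_without_e0[OF D(1) _ _ that] by blast
  qed
  then show "characteristically_nilpotent (*s) f13_bracket I"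
    using nilpotent_lie_algebra_ideal[OF nilpotent_f13] I
    unfolding characteristically_nilpotent_def by blast
qed

end
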